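(* Let $N$ be a positive integer and let $A,B\subset\mathbb{Z}$ be finite. For each positive divisor $m$ of $N$ let \[ A_m=\#\{(a,a')\in A\times A:\ (a-a',N)=m\},\qquad B_m=\#\{(b,b')\in B\times B:\ (b-b',N)=m\}, \] and for each positive divisor $d$ of $N$ let \[ \mathcal{A}_d=\sum_{\xi:\,\Phi_d(\xi)=0}|A(\xi)|^2,\qquad \mathcal{B}_d=\sum_{\xi:\,\Phi_d(\xi)=0}|B(\xi)|^2 . \] Then \[ \sum_{m|N}\frac{A_mB_m}{\phi(N/m)}=\frac1N\sum_{d|N}\frac{\mathcal{A}_d\,\mathcal{B}_d}{\phi(d)} . \]
   Context: $\phi$ is the Euler function, $(m,n)$ is the greatest common divisor, with the convention $(n,0)=n$ for $n\neq0$. $\Phi_d(x)$ is the $d$-th cyclotomic polynomial, so the sums defining $\mathcal{A}_d,\mathcal{B}_d$ run over the primitive $d$-th roots of unity $\xi\in\mathbb{C}$. For a finite set $E\subset\mathbb{Z}$, $E(\xi)=\sum_{e\in E}\xi^e$. *)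

theory Defs
  imports
    Complex_Main
    "HOL-Computational_Algebra.Polynomial"
    "HOL-Number_Theory.Totient"
begin

definition primitive_roots_of_unity :: "nat \<Rightarrow> complex set" where
  "primitive_roots_of_unity d =
     {\<xi>. d > 0 \<and> \<xi> ^ d = 1 \<and> (\<forall>k. 0 < k \<and> k < d \<longrightarrow> \<xi> ^ k \<noteq> 1)}"

definition cyclotomic :: "nat \<Rightarrow> complex poly" where
  "cyclotomic d = (\<Prod>\<xi>\<in>primitive_roots_of_unity d. [:- \<xi>, 1:])"

lemma finite_primitive_roots_of_unity: "finite (primitive_roots_of_unity d)"
proof (cases "d > 0")
  case True
  have "finite {\<xi>::complex. \<xi> ^ d = 1}"
    using True by (intro finite_roots_unity) simp
  then show ?thesis
    by (rule rev_finite_subset) (auto simp: primitive_roots_of_unity_def)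
qed (simp add: primitive_roots_of_unity_def)

lemma poly_cyclotomic_eq_0_iff:
  "poly (cyclotomic d) \<xi> = 0 \<longleftrightarrow> \<xi> \<in> primitive_roots_of_unity d"
  by (auto simp: cyclotomic_def poly_prod finite_primitive_roots_of_unity)

text \<open>
  This is \<open>E(\<xi>)\<close>; elements of \<open>E\<close> may be negative, hence the integer power.
\<close>

definition mask :: "int set \<Rightarrow> complex \<Rightarrow> complex" where
  "mask E \<xi> = (\<Sum>e\<in>E. \<xi> powi e)"

text \<open>
  This is \<open>E\<^sub>m\<close>. The diagonal pairs are counted for \<open>m = N\<close>, since \<open>gcd 0 N = N\<close>.
\<close>

definition div_count :: "nat \<Rightarrow> int set \<Rightarrow> nat \<Rightarrow> nat" where
  "div_count N E m = card {(e, e'). e \<in> E \<and> e' \<in> E \<and> gcd (e - e') (int N) = int m}"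

text \<open>
  This is the calligraphic \<open>E\<^sub>d\<close>.
\<close>

definition cyc_energy :: "int set \<Rightarrow> nat \<Rightarrow> real" where
  "cyc_energy E d = (\<Sum>\<xi> | poly (cyclotomic d) \<xi> = 0. (cmod (mask E \<xi>))\<^sup>2)"

end

theory Submission
  imports Defs "HOL-Library.Real_Mod"
begin

text \<open>
  Let \<open>c\<^sub>d(k)\<close> denote the Ramanujan sum \<open>\<Sum>\<xi>. \<xi>\<^sup>k\<close> over the primitive \<open>d\<close>-th roots of unity \<open>\<xi>\<close>.
  For \<open>d\<close> dividing \<open>N\<close> the value \<open>c\<^sub>d(k)\<close> depends on \<open>k\<close> only through \<open>gcd k N\<close>: two integers
  with the same gcd differ modulo \<open>N\<close> by a factor that is a unit modulo \<open>N\<close>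
  (\<open>same_gcd_unit_multiple\<close>), and raising to a unit power permutes the primitive \<open>d\<close>-th roots.
  Expanding \<open>|E(\<xi>)|\<^sup>2\<close> as a sum of \<open>\<xi>\<^bsup>e - e'\<^esup>\<close> and sorting the pairs by \<open>gcd (e - e') N\<close>
  therefore shows that the cyclotomic energies are linear in the divisor counts, with the matrix
  \<open>c\<^sub>d(m)\<close> (\<open>cyc_energy_eq_sum_div_count\<close>).

  The theorem is then the statement that this matrix is orthogonal for the weights in question,
  that is,
  \<open>\<Sum>d | d dvd N. c\<^sub>d(m) c\<^sub>d(m') / \<phi>(d)\<close> equals \<open>N / \<phi>(N/m)\<close> if \<open>m = m'\<close> and \<open>0\<close> otherwise,
  for divisors \<open>m\<close>, \<open>m'\<close> of \<open>N\<close> (\<open>ramanujan_sum_orthogonality\<close>).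
  With \<open>\<omega> = cis (2\<pi>/N)\<close>, the powers \<open>\<omega>\<^sup>j\<close> with \<open>gcd j N = m\<close> are the primitive \<open>N/m\<close>-th roots
  of unity, so that the double sum of \<open>\<omega>\<^bsup>j k\<^esup>\<close> over \<open>gcd j N = l\<close>, \<open>gcd k N = m\<close> can be
  evaluated by summing over either variable first. This gives the reciprocity
  \<open>\<phi>(N/m) c\<^bsub>N/l\<^esub>(m) = \<phi>(N/l) c\<^bsub>N/m\<^esub>(l)\<close>. It turns the weighted sum over \<open>d\<close> into an unweighted
  sum over all \<open>j\<close> modulo \<open>N\<close>, to which the orthogonality of the characters of \<open>\<int>/N\<close> applies.
\<close>

section \<open>Units modulo N\<close>

text \<open>
  Adding to \<open>u\<close> the multiple of \<open>d\<close> by the product of those primes of \<open>N\<close> that do not divide \<open>u\<close>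
  works: each prime of \<open>N\<close> then divides exactly one of the two summands.
\<close>

lemma coprime_lift_cong:
  fixes u :: int and d N :: nat
  assumes "N > 0" "coprime u (int d)"
  obtains v where "[v = u] (mod int d)" "coprime v (int N)"
proof -
  define Q where "Q = {p\<in>prime_factors (int N). \<not> p dvd u}"
  define v where "v = u + int d * \<Prod>Q"
  have fin: "finite Q" by (simp add: Q_def)
  have "\<not> p dvd v" if p: "prime p" "p dvd int N" for p
  proof (cases "p dvd u")
    case True
    have "\<not> p dvd int d"
      using assms(2) True p(1) by (meson coprime_common_divisor not_prime_unit)
    moreover have "\<not> p dvd \<Prod>Q"
    proof
      assume "p dvd \<Prod>Q"
      then obtain q where q: "q \<in> Q" "p dvd q"
        using p(1) fin by (auto simp: prime_dvd_prod_iff)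
      hence "p = q" using p(1) by (auto simp: Q_def intro: primes_dvd_imp_eq)
      with q True show False by (simp add: Q_def)
    qed
    ultimately show ?thesis
      using True p(1) by (simp add: v_def dvd_add_right_iff prime_dvd_mult_iff)
  next
    case False
    hence "p \<in> Q" using p assms(1) by (auto simp: Q_def in_prime_factors_iff)
    hence "p dvd int d * \<Prod>Q" using fin dvd_prodI[of Q p "\<lambda>q. q"] by simp
    with False show ?thesis by (simp add: v_def dvd_add_left_iff)
  qed
  hence "is_unit (gcd v (int N))"
    using assms(1) prime_divisor_exists[of "gcd v (int N)"] by auto
  hence "coprime v (int N)" by (simp add: coprime_iff_gcd_eq_1)
  moreover have "[v = u] (mod int d)" by (simp add: v_def cong_def)
  ultimately show thesis using that by blast
qed

text \<open>
  After division by the common gcd \<open>g\<close> both numbers are units modulo \<open>N/g\<close>. Their quotient there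
  lifts to a unit modulo \<open>N\<close>.
\<close>

lemma same_gcd_unit_multiple:
  fixes k l :: int and N :: nat
  assumes "N > 0" "gcd k (int N) = gcd l (int N)"
  obtains u where "coprime u (int N)" "[k = u * l] (mod int N)"
proof -
  define g where "g = gcd k (int N)"
  have g: "g > 0" using assms(1) by (simp add: g_def)
  obtain k' n where k': "k = k' * g" "int N = n * g" "coprime k' n"
    using g gcd_coprime_exists[of k "int N"] unfolding g_def by auto
  obtain l' n' where l': "l = l' * g" "int N = n' * g" "coprime l' n'"
    using g gcd_coprime_exists[of l "int N"] unfolding g_def assms(2) by auto
  have [simp]: "n' = n" using k' l' g by simp
  have "n > 0" using k'(2) g assms(1) by (metis of_nat_0_less_iff zero_less_mult_pos2)
  then have n: "n = int (nat n)" by simp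
  obtain w where w: "[l' * w = 1] (mod n)"
    using l'(3) cong_solve_coprime_int by auto
  hence "coprime w n" using l'(3)
    by (metis cong_imp_coprime cong_sym coprime_1_left coprime_mult_left_iff)
  hence "coprime (k' * w) (int (nat n))" using k'(3) n by simp
  then obtain u where u: "[u = k' * w] (mod n)" "coprime u (int N)"
    using coprime_lift_cong[OF assms(1)] n by metis
  have "[u * l' = (k' * w) * l'] (mod n)" using u(1) by (rule cong_scalar_right)
  also have "(k' * w) * l' = k' * (l' * w)" by simp
  also have "[k' * (l' * w) = k' * 1] (mod n)" using w by (rule cong_scalar_left)
  finally have "[k' * g = u * l' * g] (mod (n * g))"
    by (simp add: cong_iff_dvd_diff dvd_diff_commute flip: left_diff_distrib)
  hence "[k = u * l] (mod int N)" by (simp add: k' l' mult.assoc)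
  with u(2) show thesis using that by blast
qed

section \<open>Ramanujan sums\<close>

definition ramanujan_sum :: "nat \<Rightarrow> int \<Rightarrow> complex" where
  "ramanujan_sum d k = (\<Sum>\<xi>\<in>primitive_roots_of_unity d. \<xi> powi k)"

lemma primitive_root_powi_cong:
  assumes "\<xi> \<in> primitive_roots_of_unity d" "d dvd N" "[k = l] (mod int N)"
  shows "\<xi> powi k = \<xi> powi l"
proof -
  have "\<xi> ^ d = 1" "d > 0" using assms(1) by (auto simp: primitive_roots_of_unity_def)
  hence nz: "\<xi> \<noteq> 0" by (auto simp: power_0_left)
  have "int d dvd k - l" using assms(2,3)
    by (metis cong_iff_dvd_diff dvd_trans of_nat_dvd_iff)
  then obtain t where "k - l = int d * t" ..
  hence "\<xi> powi (k - l) = 1" using \<open>\<xi> ^ d = 1\<close> by (simp add: power_int_mult)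
  thus ?thesis using nz by (simp add: power_int_diff)
qed

text \<open>
  Raising to an inverse of \<open>u\<close> modulo \<open>N\<close> undoes the map, and this is also why the map preserves
  the order of a root.
\<close>

lemma bij_betw_primitive_roots_powi:
  assumes "d dvd N" "coprime u (int N)"
  shows "bij_betw (\<lambda>\<xi>. \<xi> powi u) (primitive_roots_of_unity d) (primitive_roots_of_unity d)"
proof -
  obtain w where w: "[u * w = 1] (mod int N)" using assms(2) cong_solve_coprime_int by auto
  hence "coprime w (int N)" using assms(2)
    by (metis cong_imp_coprime cong_sym coprime_1_left coprime_mult_left_iff)
  have inv: "(\<xi> powi x) powi y = \<xi>"
    if "\<xi> \<in> primitive_roots_of_unity d" "[x * y = 1] (mod int N)" for \<xi> x y
    using primitive_root_powi_cong[OF that(1) assms(1) that(2)] by (simp add: power_int_mult)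
  have closed: "\<xi> powi x \<in> primitive_roots_of_unity d"
    if \<xi>: "\<xi> \<in> primitive_roots_of_unity d" and xy: "[x * y = 1] (mod int N)" for \<xi> x y
  proof -
    have "(\<xi> powi x) ^ d = 1"
      using \<xi> by (simp add: primitive_roots_of_unity_def power_int_power' mult.commute[of x]
        flip: power_int_power)
    moreover have "(\<xi> powi x) ^ k \<noteq> 1" if "0 < k" "k < d" for k
    proof
      assume 1: "(\<xi> powi x) ^ k = 1"
      have "\<xi> ^ k = ((\<xi> powi x) powi y) ^ k" using inv[OF \<xi> xy] by simp
      also have "\<dots> = ((\<xi> powi x) ^ k) powi y"
        by (simp add: power_int_power' mult_ac flip: power_int_mult)
      finally show False using 1 \<xi> that by (auto simp: primitive_roots_of_unity_def)
    qed
    ultimately show ?thesis using \<xi> by (auto simp: primitive_roots_of_unity_def)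
  qed
  have w': "[w * u = 1] (mod int N)" using w by (simp add: mult.commute)
  show ?thesis
    by (rule bij_betw_byWitness[of _ "\<lambda>\<xi>. \<xi> powi w"]) (use inv closed w w' in auto)
qed

lemma ramanujan_sum_cong_gcd:
  assumes "N > 0" "d dvd N" "gcd k (int N) = gcd l (int N)"
  shows "ramanujan_sum d k = ramanujan_sum d l"
proof -
  obtain u where u: "coprime u (int N)" "[k = u * l] (mod int N)"
    using same_gcd_unit_multiple[OF assms(1,3)] .
  have "ramanujan_sum d k = (\<Sum>\<xi>\<in>primitive_roots_of_unity d. (\<xi> powi u) powi l)"
    unfolding ramanujan_sum_def
    using primitive_root_powi_cong[OF _ assms(2) u(2)]
    by (intro sum.cong) (auto simp: power_int_mult)
  also have "\<dots> = ramanujan_sum d l"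
    unfolding ramanujan_sum_def
    by (rule sum.reindex_bij_betw[OF bij_betw_primitive_roots_powi[OF assms(2) u(1)]])
  finally show ?thesis .
qed

section \<open>Roots of unity as powers of one generator\<close>

definition unit_root :: "nat \<Rightarrow> complex" where
  "unit_root N = cis (2 * pi / real N)"

lemma unit_root_nonzero [simp]: "unit_root N \<noteq> 0"
  by (simp add: unit_root_def)

lemma unit_root_powi_eq_1_iff:
  assumes "N > 0"
  shows "unit_root N powi n = 1 \<longleftrightarrow> int N dvd n"
proof -
  have "unit_root N powi n = 1 \<longleftrightarrow> (\<exists>m. real_of_int n * (2 * pi / real N) = of_int m * (2 * pi))"
    by (simp add: unit_root_def cis_power_int cis_eq_1_iff)
  also have "\<dots> \<longleftrightarrow> (\<exists>m. real_of_int n = of_int (int N * m))"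
    using assms by (simp add: field_simps)
  also have "\<dots> \<longleftrightarrow> int N dvd n" by (simp only: of_int_eq_iff dvd_def)
  finally show ?thesis .
qed

lemma bij_betw_unit_root_power:
  assumes "N > 0"
  shows "bij_betw (\<lambda>j. unit_root N ^ j) {0<..N} {z. z ^ N = 1}"
proof -
  have inj: "inj_on (\<lambda>j. unit_root N ^ j) {0<..N}"
  proof (rule inj_onI)
    fix j k assume jk: "j \<in> {0<..N}" "k \<in> {0<..N}" "unit_root N ^ j = unit_root N ^ k"
    have "unit_root N powi (int j - int k) = 1"
      using jk(3) by (simp add: power_int_diff)
    hence "int N dvd int j - int k" using assms by (simp add: unit_root_powi_eq_1_iff)
    moreover have "\<bar>int j - int k\<bar> < int N" using jk by auto
    ultimately show "j = k" by (metis dvd_imp_le_int leD abs_of_nat eq_iff_diff_eq_0 of_nat_eq_iff)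
  qed
  have "(unit_root N ^ j) ^ N = 1" for j
    using unit_root_powi_eq_1_iff[OF assms, of "int (j * N)"]
    unfolding power_int_of_nat of_nat_dvd_iff by (simp add: power_mult)
  hence "(\<lambda>j. unit_root N ^ j) ` {0<..N} = {z. z ^ N = 1}"
    using assms by (intro card_subset_eq) (auto simp: finite_roots_unity card_image[OF inj] card_roots_unity_eq)
  with inj show ?thesis by (simp add: bij_betw_def)
qed

text \<open>
  The order of \<open>\<omega>\<^sup>j\<close>, for \<open>\<omega>\<close> of order \<open>N\<close>, is \<open>N / gcd j N\<close>.
\<close>

lemma unit_root_power_primitive_iff:
  assumes "N > 0" "m dvd N"
  shows "unit_root N ^ j \<in> primitive_roots_of_unity (N div m) \<longleftrightarrow> gcd j N = m"
proof -
  define g where "g = gcd j N"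
  define e where "e = N div g"
  define d where "d = N div m"
  have g: "g > 0" "g dvd N" using assms by (auto simp: g_def)
  have e: "e > 0" using assms g by (simp add: e_def div_greater_zero_iff dvd_imp_le)
  have d: "d > 0" using assms by (auto simp: d_def div_greater_zero_iff intro: dvd_imp_le dvd_pos_nat)
  have order: "(unit_root N ^ j) ^ k = 1 \<longleftrightarrow> e dvd k" for k
  proof -
    have "(unit_root N ^ j) ^ k = 1 \<longleftrightarrow> N dvd j * k"
      using unit_root_powi_eq_1_iff[OF assms(1), of "int (j * k)"]
      unfolding power_int_of_nat of_nat_dvd_iff by (simp add: power_mult)
    also have "\<dots> \<longleftrightarrow> e dvd k"
    proof -
      obtain j' where j': "j = g * j'" unfolding g_def by (meson dvd_def gcd_dvd1)
      have N: "N = g * e" using g by (simp add: e_def)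
      have "g = g * gcd j' e" using g_def j' N by (metis gcd_mult_distrib_nat)
      hence "gcd j' e = 1" using g(1) by (metis mult_eq_self_implies_10 less_irrefl)
      hence "coprime e j'" by (simp add: coprime_iff_gcd_eq_1 gcd.commute)
      thus ?thesis using g(1) by (simp add: j' N mult.assoc coprime_dvd_mult_right_iff)
    qed
    finally show ?thesis .
  qed
  have "unit_root N ^ j \<in> primitive_roots_of_unity d \<longleftrightarrow> d = e"
  proof
    assume "unit_root N ^ j \<in> primitive_roots_of_unity d"
    hence "e dvd d" "\<not> e < d" using e by (auto simp: primitive_roots_of_unity_def order)
    thus "d = e" using d by (auto dest: dvd_imp_le)
  next
    assume "d = e"
    thus "unit_root N ^ j \<in> primitive_roots_of_unity d"
      using e by (auto simp: primitive_roots_of_unity_def order dest: dvd_imp_le)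
  qed
  also have "d = e \<longleftrightarrow> g = m"
  proof
    assume "d = e"
    moreover have "N = g * e" "N = m * d" using g assms by (auto simp: e_def d_def)
    ultimately show "g = m" using d by (metis mult_right_cancel neq0_conv)
  qed (simp add: d_def e_def)
  finally show ?thesis by (simp add: d_def g_def)
qed

lemma bij_betw_unit_root_power_primitive:
  assumes "N > 0" "m dvd N"
  shows "bij_betw (\<lambda>j. unit_root N ^ j) {j\<in>{0<..N}. gcd j N = m} (primitive_roots_of_unity (N div m))"
proof (rule bij_betw_subset[OF bij_betw_unit_root_power[OF assms(1)]])
  show "(\<lambda>j. unit_root N ^ j) ` {j\<in>{0<..N}. gcd j N = m} = primitive_roots_of_unity (N div m)"
  proof (intro equalityI subsetI)
    fix \<xi> assume \<xi>: "\<xi> \<in> primitive_roots_of_unity (N div m)"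
    have "N = (N div m) * m" using assms(2) by simp
    hence "\<xi> ^ N = (\<xi> ^ (N div m)) ^ m" by (metis power_mult)
    hence "\<xi> ^ N = 1" using \<xi> by (simp add: primitive_roots_of_unity_def)
    hence "\<xi> \<in> (\<lambda>j. unit_root N ^ j) ` {0<..N}"
      using bij_betw_unit_root_power[OF assms(1)] by (simp add: bij_betw_def)
    then obtain j where "j \<in> {0<..N}" "\<xi> = unit_root N ^ j" by blast
    thus "\<xi> \<in> (\<lambda>j. unit_root N ^ j) ` {j\<in>{0<..N}. gcd j N = m}"
      using \<xi> unit_root_power_primitive_iff[OF assms] by auto
  qed (use unit_root_power_primitive_iff[OF assms] in auto)
qed auto

lemma ramanujan_sum_eq_sum_unit_root:
  assumes "N > 0" "m dvd N"
  shows "ramanujan_sum (N div m) k = (\<Sum>j | j \<in> {0<..N} \<and> gcd j N = m. unit_root N powi (int j * k))"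
  unfolding ramanujan_sum_def
  by (subst sum.reindex_bij_betw[OF bij_betw_unit_root_power_primitive[OF assms], symmetric])
     (simp add: power_int_power)

section \<open>Orthogonality of Ramanujan sums\<close>

lemma sum_unit_root_powi:
  assumes "N > 0"
  shows "(\<Sum>j\<in>{0<..N}. unit_root N powi (int j * n)) = (if int N dvd n then of_nat N else 0)"
proof -
  define z where "z = unit_root N powi n"
  have z1: "z = 1 \<longleftrightarrow> int N dvd n" by (simp add: z_def unit_root_powi_eq_1_iff[OF assms])
  have zN: "z ^ N = 1"
    by (simp add: z_def power_int_power' unit_root_powi_eq_1_iff[OF assms])
  have "(\<Sum>j\<in>{0<..N}. unit_root N powi (int j * n)) = (\<Sum>j\<in>{0<..N}. z ^ j)"
    by (simp add: z_def power_int_power' mult.commute)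
  also have "\<dots> = (\<Sum>j\<in>Suc ` {..<N}. z ^ j)"
    by (intro sum.cong) (auto simp: image_Suc_lessThan)
  also have "\<dots> = z * (\<Sum>j<N. z ^ j)"
    by (subst sum.reindex) (auto simp: sum_distrib_left)
  also have "\<dots> = (if int N dvd n then of_nat N else 0)"
    using zN z1 by (cases "z = 1") (auto simp: geometric_sum)
  finally show ?thesis .
qed

text \<open>
  Both sides are the sum of \<open>\<omega>\<^bsup>j k\<^esup>\<close> over all \<open>j, k\<close> modulo \<open>N\<close> with \<open>gcd j N = l\<close> and
  \<open>gcd k N = m\<close>, where \<open>\<omega>\<close> is a primitive \<open>N\<close>-th root of unity: the inner sum over either
  variable is a Ramanujan sum that is constant in the other one.
\<close>

lemma ramanujan_sum_reciprocity:
  assumes "N > 0" "l dvd N" "m dvd N"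
  shows "of_nat (totient (N div m)) * ramanujan_sum (N div l) (int m) =
         of_nat (totient (N div l)) * ramanujan_sum (N div m) (int l)"
proof -
  define C where "C = (\<lambda>m. {j. j \<in> {0<..N} \<and> gcd j N = m})"
  have card: "card (C m) = totient (N div m)" if "m dvd N" for m
    using card_gcd_eq_totient[OF assms(1) that] by (simp add: C_def)
  have inner: "(\<Sum>j\<in>C l. unit_root N powi (int j * int k)) = ramanujan_sum (N div l) (int m)"
    if "l dvd N" "k \<in> C m" for k l m
  proof -
    have "(\<Sum>j\<in>C l. unit_root N powi (int j * int k)) = ramanujan_sum (N div l) (int k)"
      using ramanujan_sum_eq_sum_unit_root[OF assms(1) that(1)] by (simp add: C_def)
    also have "\<dots> = ramanujan_sum (N div l) (int m)"
      using that assms(1) by (intro ramanujan_sum_cong_gcd[of N]) (auto simp: C_def)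
    finally show ?thesis .
  qed
  have "of_nat (totient (N div m)) * ramanujan_sum (N div l) (int m)
      = (\<Sum>k\<in>C m. \<Sum>j\<in>C l. unit_root N powi (int j * int k))"
    using inner[OF assms(2), of _ m] card[OF assms(3)] by simp
  also have "\<dots> = (\<Sum>j\<in>C l. \<Sum>k\<in>C m. unit_root N powi (int k * int j))"
    by (subst sum.swap) (simp add: mult.commute)
  also have "\<dots> = of_nat (totient (N div l)) * ramanujan_sum (N div m) (int l)"
    using inner[OF assms(3), of _ l] card[OF assms(2)] by simp
  finally show ?thesis .
qed

text \<open>
  With \<open>d = N/l\<close>, reciprocity trades the weight \<open>1 / \<phi>(N/l)\<close>, which varies with \<open>l\<close>, for the
  constant \<open>1 / \<phi>(N/m')\<close>. The sums over the classes \<open>gcd j N = l\<close> then join into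
  one sum over all \<open>j\<close> modulo \<open>N\<close>, which selects the \<open>k\<close> with \<open>gcd k N = m'\<close> and
  \<open>m + k\<close> divisible by \<open>N\<close>.
\<close>

lemma ramanujan_sum_orthogonality:
  assumes "N > 0" "m dvd N" "m' dvd N"
  shows "(\<Sum>d | d dvd N. ramanujan_sum d (int m) * ramanujan_sum d (int m') / of_nat (totient d)) =
         (if m = m' then of_nat N / of_nat (totient (N div m)) else 0)"
proof -
  define C where "C = (\<lambda>m. {j. j \<in> {0<..N} \<and> gcd j N = m})"
  define t :: complex where "t = of_nat (totient (N div m'))"
  have tpos: "totient (N div l) > 0" if "l dvd N" for l
    using that assms(1) by (auto simp: div_greater_zero_iff intro: dvd_imp_le dvd_pos_nat)
  have t: "t \<noteq> 0" using tpos[OF assms(3)] by (simp add: t_def)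
  have fin: "finite {l. l dvd N}" using assms(1) by simp
  have "(\<Sum>d | d dvd N. ramanujan_sum d (int m) * ramanujan_sum d (int m') / of_nat (totient d))
      = (\<Sum>l | l dvd N. ramanujan_sum (N div l) (int m) * ramanujan_sum (N div l) (int m')
           / of_nat (totient (N div l)))"
    using assms(1) by (intro sum.reindex_bij_witness[of _ "(div) N" "(div) N"]) (auto elim: dvdE)
  also have "\<dots> = (\<Sum>l | l dvd N. ramanujan_sum (N div l) (int m) * ramanujan_sum (N div m') (int l) / t)"
  proof (intro sum.cong refl)
    fix l assume "l \<in> {l. l dvd N}"
    hence l: "l dvd N" by simp
    have "ramanujan_sum (N div l) (int m') / of_nat (totient (N div l)) = ramanujan_sum (N div m') (int l) / t"
      using ramanujan_sum_reciprocity[OF assms(1) l assms(3)] tpos[OF l] t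
      unfolding t_def by (simp add: frac_eq_eq mult.commute)
    thus "ramanujan_sum (N div l) (int m) * ramanujan_sum (N div l) (int m') / of_nat (totient (N div l))
        = ramanujan_sum (N div l) (int m) * ramanujan_sum (N div m') (int l) / t"
      by (metis times_divide_eq_right)
  qed
  also have "\<dots> = (\<Sum>l | l dvd N. \<Sum>j\<in>C l. unit_root N powi (int j * int m) * ramanujan_sum (N div m') (int j)) / t"
    unfolding sum_divide_distrib
  proof (intro sum.cong refl)
    fix l assume "l \<in> {l. l dvd N}"
    hence l: "l dvd N" by simp
    have "ramanujan_sum (N div m') (int j) = ramanujan_sum (N div m') (int l)" if "j \<in> C l" for j
      using that assms l by (intro ramanujan_sum_cong_gcd[of N]) (auto simp: C_def)
    thus "ramanujan_sum (N div l) (int m) * ramanujan_sum (N div m') (int l) / t =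
      (\<Sum>j\<in>C l. unit_root N powi (int j * int m) * ramanujan_sum (N div m') (int j) / t)"
      using ramanujan_sum_eq_sum_unit_root[OF assms(1) l, of "int m"]
      by (simp add: C_def sum_distrib_right sum_divide_distrib)
  qed
  also have "(\<Sum>l | l dvd N. \<Sum>j\<in>C l. unit_root N powi (int j * int m) * ramanujan_sum (N div m') (int j))
      = (\<Sum>j\<in>{0<..N}. unit_root N powi (int j * int m) * ramanujan_sum (N div m') (int j))"
    unfolding C_def using fin by (intro sum.group) auto
  also have "\<dots> = (\<Sum>j\<in>{0<..N}. \<Sum>k\<in>C m'. unit_root N powi (int j * (int m + int k)))"
    unfolding ramanujan_sum_eq_sum_unit_root[OF assms(1,3)] C_def sum_distrib_left
    by (intro sum.cong refl) (simp add: power_int_add distrib_left mult.commute)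
  also have "\<dots> = (\<Sum>k\<in>C m'. if int N dvd int m + int k then of_nat N else 0)"
    by (subst sum.swap) (simp only: sum_unit_root_powi[OF assms(1)])
  also have "\<dots> = (if m = m' then of_nat N else 0)"
  proof -
    \<comment> \<open>Only \<open>k = N - m\<close> contributes, or \<open>k = N\<close> if \<open>m = N\<close>; its gcd with \<open>N\<close> is \<open>m\<close>.\<close>
    define k0 where "k0 = (if m = N then N else N - m)"
    have mN: "m > 0" "m \<le> N" using assms by (auto intro: dvd_imp_le dvd_pos_nat)
    have k0: "k0 \<in> {0<..N}" using mN assms(1) by (auto simp: k0_def)
    have "gcd k0 N = m"
      using assms(2) mN by (auto simp: k0_def gcd_diff2_nat gcd_nat.absorb1)
    have "int N dvd int m + int k \<longleftrightarrow> k = k0" if "k \<in> {0<..N}" for k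
    proof
      assume "int N dvd int m + int k"
      moreover have "int N dvd int m + int k0" using mN by (auto simp: k0_def of_nat_diff)
      ultimately have "int N dvd (int m + int k) - (int m + int k0)" by (rule dvd_diff)
      hence "int N dvd int k - int k0" by simp
      moreover have "\<bar>int k - int k0\<bar> < int N" using that k0 by auto
      ultimately show "k = k0"
        by (metis dvd_imp_le_int leD abs_of_nat eq_iff_diff_eq_0 of_nat_eq_iff)
    qed (use mN in \<open>auto simp: k0_def of_nat_diff\<close>)
    hence "(\<Sum>k\<in>C m'. if int N dvd int m + int k then of_nat N else 0)
        = (\<Sum>k\<in>C m'. if k = k0 then of_nat N else (0::complex))"
      by (intro sum.cong) (auto simp: C_def)
    also have "\<dots> = (if k0 \<in> C m' then of_nat N else 0)"
      by (simp add: C_def sum.delta)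
    also have "k0 \<in> C m' \<longleftrightarrow> m = m'" using k0 \<open>gcd k0 N = m\<close> by (auto simp: C_def)
    finally show ?thesis .
  qed
  finally show ?thesis by (auto simp: t_def)
qed

section \<open>Energies as linear combinations of divisor counts\<close>

lemma cyc_energy_eq_sum_div_count:
  assumes "N > 0" "finite E" "d dvd N"
  shows "complex_of_real (cyc_energy E d) =
         (\<Sum>m | m dvd N. of_nat (div_count N E m) * ramanujan_sum d (int m))"
proof -
  have sq: "complex_of_real ((cmod (mask E \<xi>))\<^sup>2) = (\<Sum>p\<in>E \<times> E. \<xi> powi (fst p - snd p))"
    if \<xi>: "\<xi> \<in> primitive_roots_of_unity d" for \<xi>
  proof -
    have "\<xi> ^ d = 1" "d > 0" using \<xi> by (auto simp: primitive_roots_of_unity_def)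
    hence n1: "cmod \<xi> = 1"
      by (metis norm_one norm_power norm_ge_zero power_eq_1_iff neq0_conv abs_of_nonneg real_norm_def)
    hence nz: "\<xi> \<noteq> 0" by auto
    have cnj: "cnj \<xi> = inverse \<xi>"
      using n1 complex_norm_square[of \<xi>] by (metis inverse_unique of_real_1 power_one)
    have "complex_of_real ((cmod (mask E \<xi>))\<^sup>2) = mask E \<xi> * cnj (mask E \<xi>)"
      by (rule complex_norm_square)
    also have "cnj (mask E \<xi>) = (\<Sum>e\<in>E. \<xi> powi (- e))"
      by (simp add: mask_def cnj power_int_minus power_int_inverse)
    also have "mask E \<xi> * \<dots> = (\<Sum>p\<in>E \<times> E. \<xi> powi (fst p - snd p))"
      unfolding mask_def sum_product sum.cartesian_product
      using nz by (intro sum.cong) (auto simp: power_int_diff power_int_minus field_simps)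
    finally show ?thesis .
  qed
  have "complex_of_real (cyc_energy E d)
      = (\<Sum>\<xi>\<in>primitive_roots_of_unity d. complex_of_real ((cmod (mask E \<xi>))\<^sup>2))"
    by (simp add: cyc_energy_def poly_cyclotomic_eq_0_iff)
  also have "\<dots> = (\<Sum>\<xi>\<in>primitive_roots_of_unity d. \<Sum>p\<in>E \<times> E. \<xi> powi (fst p - snd p))"
    by (intro sum.cong refl sq)
  also have "\<dots> = (\<Sum>p\<in>E \<times> E. ramanujan_sum d (fst p - snd p))"
    unfolding ramanujan_sum_def by (rule sum.swap)
  also have "\<dots> = (\<Sum>m | m dvd N. \<Sum>p | p \<in> E \<times> E \<and> nat (gcd (fst p - snd p) (int N)) = m.
      ramanujan_sum d (fst p - snd p))"
    using assms(1,2) by (intro sum.group[symmetric]) (auto simp: nat_dvd_iff)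
  also have "\<dots> = (\<Sum>m | m dvd N. of_nat (div_count N E m) * ramanujan_sum d (int m))"
  proof (intro sum.cong refl)
    fix m assume "m \<in> {m. m dvd N}"
    hence m: "m dvd N" by simp
    define S where "S = {p. p \<in> E \<times> E \<and> nat (gcd (fst p - snd p) (int N)) = m}"
    have "ramanujan_sum d (fst p - snd p) = ramanujan_sum d (int m)" if "p \<in> S" for p
      using that assms m by (intro ramanujan_sum_cong_gcd[of N]) (auto simp: S_def)
    hence "(\<Sum>p\<in>S. ramanujan_sum d (fst p - snd p)) = of_nat (card S) * ramanujan_sum d (int m)"
      by simp
    moreover have "S = {(e, e'). e \<in> E \<and> e' \<in> E \<and> gcd (e - e') (int N) = int m}"
      by (auto simp: S_def)
    ultimately show "(\<Sum>p | p \<in> E \<times> E \<and> nat (gcd (fst p - snd p) (int N)) = m.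
        ramanujan_sum d (fst p - snd p)) = of_nat (div_count N E m) * ramanujan_sum d (int m)"
      by (simp add: S_def div_count_def)
  qed
  finally show ?thesis .
qed

theorem theorem1p2:
  fixes N :: nat and A B :: "int set"
  assumes "N > 0" and "finite A" and "finite B"
  shows "(\<Sum>m | m dvd N. real (div_count N A m) * real (div_count N B m) / real (totient (N div m)))
       = 1 / real N * (\<Sum>d | d dvd N. cyc_energy A d * cyc_energy B d / real (totient d))"
proof -
  let ?D = "{m. m dvd N}"
  define a :: "nat \<Rightarrow> complex" where "a = (\<lambda>m. of_nat (div_count N A m))"
  define b :: "nat \<Rightarrow> complex" where "b = (\<lambda>m. of_nat (div_count N B m))"
  define c where "c = (\<lambda>d m. ramanujan_sum d (int m))"
  have fin: "finite ?D" using assms(1) by simp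
  have "complex_of_real (\<Sum>d | d dvd N. cyc_energy A d * cyc_energy B d / real (totient d))
      = (\<Sum>d\<in>?D. (\<Sum>m\<in>?D. a m * c d m) * (\<Sum>m'\<in>?D. b m' * c d m') / of_nat (totient d))"
    unfolding of_real_sum a_def b_def c_def
    by (intro sum.cong refl)
       (simp add: cyc_energy_eq_sum_div_count[OF assms(1,2)] cyc_energy_eq_sum_div_count[OF assms(1,3)])
  also have "\<dots> = (\<Sum>d\<in>?D. \<Sum>m\<in>?D. \<Sum>m'\<in>?D. a m * b m' * (c d m * c d m' / of_nat (totient d)))"
    unfolding sum_product sum_divide_distrib by (intro sum.cong refl) simp
  also have "\<dots> = (\<Sum>m\<in>?D. \<Sum>d\<in>?D. \<Sum>m'\<in>?D. a m * b m' * (c d m * c d m' / of_nat (totient d)))"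
    by (rule sum.swap)
  also have "\<dots> = (\<Sum>m\<in>?D. \<Sum>m'\<in>?D. \<Sum>d\<in>?D. a m * b m' * (c d m * c d m' / of_nat (totient d)))"
    by (intro sum.cong refl sum.swap)
  also have "\<dots> = (\<Sum>m\<in>?D. \<Sum>m'\<in>?D. a m * b m' * (\<Sum>d\<in>?D. c d m * c d m' / of_nat (totient d)))"
    by (simp only: sum_distrib_left)
  also have "\<dots> = (\<Sum>m\<in>?D. \<Sum>m'\<in>?D. if m = m' then a m * b m' * (of_nat N / of_nat (totient (N div m))) else 0)"
    unfolding c_def
    by (intro sum.cong refl) (simp add: ramanujan_sum_orthogonality[OF assms(1)])
  also have "\<dots> = (\<Sum>m\<in>?D. a m * b m * (of_nat N / of_nat (totient (N div m))))"
    using fin by (intro sum.cong refl) (simp add: sum.delta')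
  also have "\<dots> = complex_of_real (real N *
      (\<Sum>m | m dvd N. real (div_count N A m) * real (div_count N B m) / real (totient (N div m))))"
    unfolding of_real_sum of_real_mult sum_distrib_left a_def b_def
    by (intro sum.cong refl) simp
  finally show ?thesis using assms(1) unfolding of_real_eq_iff by simp
qed

end
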